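(* Let $(S,\Sigma)$ be a scaled $\mathrm{Cu}$-semigroup satisfying (O6) that has an abundance of strongly soft elements. Then $S$ is weakly $(2,\omega)$-divisible. Consequently, if a $C^*$-algebra has an abundance of soft elements, then it is nowhere scattered.
   Context: In a partially ordered set in which suprema of increasing sequences exist, $x\ll y$ means that for every increasing sequence $(z_n)_n$ with $y\leq\sup_nz_n$ there is $n$ with $x\leq z_n$. A $\mathrm{Cu}$-semigroup is a commutative monoid $S$ with a translation-invariant partial order in which $0\leq x$ for all $x$, such that: (O1) every increasing sequence has a supremum; (O2) every element is the supremum of a sequence $(x_n)_n$ with $x_n\ll x_{n+1}$ for all $n$; (O3) $x'\ll x$ and $y'\ll y$ imply $x'+y'\ll x+y$; (O4) $\sup_n(x_n+y_n)=\sup_nx_n+\sup_ny_n$ for increasing sequences. We write $\infty y:=\sup_nny$. An ideal of $S$ is a submonoid that is downward-hereditary and closed under suprema of increasing sequences. A scale in $S$ is a subset $\Sigma\subseteq S$ that is downward-hereditary, closed under suprema of increasing sequences, and generates $S$ as an ideal; then $(S,\Sigma)$ is a scaled $\mathrm{Cu}$-semigroup. (O6): given $x',x,y,z\in S$ with $x'\ll x\leq y+z$, there are $e,f\in S$ with $e\leq x,y$, $f\leq x,z$ and $x'\leq e+f$. An element $x\in S$ is strongly soft if for every $x'\in S$ with $x'\ll x$ there is $t\in S$ with $x'+t\ll x$ and $x'\ll\infty t$. $(S,\Sigma)$ has an abundance of strongly soft elements if for all $x',x\in\Sigma$ with $x'\ll x$ there is a strongly soft $y\in S$ with $x'\leq\infty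 y$ and $y\leq x$. $S$ is weakly $(2,\omega)$-divisible if for all $x'\ll x$ in $S$ there are finitely many $y_1,\ldots,y_n\in S$ with $x'\leq y_1+\cdots+y_n$ and $2y_j\leq x$ for each $j$. $C^*$-algebras: a $C^*$-algebra $B$ is soft if for every proper closed two-sided ideal $I\subseteq B$ the quotient $B/I$ is nonunital; $b\in A_+$ is soft if $\overline{bAb}$ is soft. $A$ has an abundance of soft elements if for every $a\in A_+$ and $\varepsilon>0$ there is a positive, soft element $b\in\overline{aAa}$ such that $(a-\varepsilon)_+$ (functional calculus with $t\mapsto\max(t-\varepsilon,0)$) is in the closed two-sided ideal of $A$ generated by $b$. $A$ is nowhere scattered if it has no nonzero elementary ideal-quotients, i.e. there are no closed two-sided ideals $J\subseteq I\subseteq A$ such that $I/J$ is isomorphic to the algebra of compact operators on some nonzero Hilbert space. *)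

theory Defs
  imports
    "HOL-Analysis.Analysis"
    "HOL-Computational_Algebra.Polynomial"
begin

section \<open>Cu-semigroups\<close>

context order
begin

definition increasing_seq :: "(nat \<Rightarrow> 'a) \<Rightarrow> bool" where
  "increasing_seq z \<longleftrightarrow> (\<forall>n. z n \<le> z (Suc n))"

definition seq_sup :: "(nat \<Rightarrow> 'a) \<Rightarrow> 'a \<Rightarrow> bool" where
  "seq_sup z s \<longleftrightarrow> (\<forall>n. z n \<le> s) \<and> (\<forall>u. (\<forall>n. z n \<le> u) \<longrightarrow> s \<le> u)"

definition way_below :: "'a \<Rightarrow> 'a \<Rightarrow> bool" (infix "\<lless>" 50) where
  "x \<lless> y \<longleftrightarrow> (\<forall>z s. increasing_seq z \<and> seq_sup z s \<and> y \<le> s \<longrightarrow> (\<exists>n. x \<le> z n))"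

end

class cu_semigroup = ordered_comm_monoid_add +
  assumes Cu_zero_le: "0 \<le> x"
    and Cu_O1: "increasing_seq z \<Longrightarrow> \<exists>s. seq_sup z s"
    and Cu_O2: "\<exists>z. (\<forall>n. z n \<lless> z (Suc n)) \<and> seq_sup z x"
    and Cu_O3: "x' \<lless> x \<Longrightarrow> y' \<lless> y \<Longrightarrow> x' + y' \<lless> x + y"
    and Cu_O4: "increasing_seq z \<Longrightarrow> increasing_seq w \<Longrightarrow> seq_sup z s \<Longrightarrow> seq_sup w t
                  \<Longrightarrow> seq_sup (\<lambda>n. z n + w n) (s + t)"

text \<open>The element \<open>\<infinity>y = sup\<^sub>n n y\<close>; it exists by (O1) and is unique by antisymmetry.\<close>

definition infinite_multiple :: "'a::cu_semigroup \<Rightarrow> 'a" where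
  "infinite_multiple y = (THE s. seq_sup (\<lambda>n. \<Sum>i<n. y) s)"

definition cu_hereditary :: "'a::cu_semigroup set \<Rightarrow> bool" where
  "cu_hereditary X \<longleftrightarrow> (\<forall>x\<in>X. \<forall>y. y \<le> x \<longrightarrow> y \<in> X)"

definition cu_sup_closed :: "'a::cu_semigroup set \<Rightarrow> bool" where
  "cu_sup_closed X \<longleftrightarrow> (\<forall>z s. increasing_seq z \<and> range z \<subseteq> X \<and> seq_sup z s \<longrightarrow> s \<in> X)"

definition cu_ideal :: "'a::cu_semigroup set \<Rightarrow> bool" where
  "cu_ideal I \<longleftrightarrow> 0 \<in> I \<and> (\<forall>x\<in>I. \<forall>y\<in>I. x + y \<in> I) \<and> cu_hereditary I \<and> cu_sup_closed I"

definition cu_scale :: "'a::cu_semigroup set \<Rightarrow> bool" where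
  "cu_scale \<Sigma> \<longleftrightarrow> cu_hereditary \<Sigma> \<and> cu_sup_closed \<Sigma> \<and> cu_ideal hull \<Sigma> = UNIV"

definition property_O6 :: "'a::cu_semigroup itself \<Rightarrow> bool" where
  "property_O6 _ \<longleftrightarrow> (\<forall>(x'::'a) x y z. x' \<lless> x \<and> x \<le> y + z \<longrightarrow>
     (\<exists>e f. e \<le> x \<and> e \<le> y \<and> f \<le> x \<and> f \<le> z \<and> x' \<le> e + f))"

definition strongly_soft :: "'a::cu_semigroup \<Rightarrow> bool" where
  "strongly_soft x \<longleftrightarrow>
     (\<forall>x'. x' \<lless> x \<longrightarrow> (\<exists>t. x' + t \<lless> x \<and> x' \<lless> infinite_multiple t))"

definition abundance_of_strongly_soft_elements :: "'a::cu_semigroup set \<Rightarrow> bool" where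
  "abundance_of_strongly_soft_elements \<Sigma> \<longleftrightarrow>
     (\<forall>x'\<in>\<Sigma>. \<forall>x\<in>\<Sigma>. x' \<lless> x \<longrightarrow>
        (\<exists>y. strongly_soft y \<and> x' \<le> infinite_multiple y \<and> y \<le> x))"

definition weakly_2_omega_divisible :: "'a::cu_semigroup itself \<Rightarrow> bool" where
  "weakly_2_omega_divisible _ \<longleftrightarrow> (\<forall>(x'::'a) x. x' \<lless> x \<longrightarrow>
     (\<exists>ys. x' \<le> sum_list ys \<and> (\<forall>y\<in>set ys. y + y \<le> x)))"


section \<open>Complex Banach spaces, Hilbert spaces and C*-algebras\<close>

class complex_banach = banach +
  fixes scaleC :: "complex \<Rightarrow> 'a \<Rightarrow> 'a" (infixr "*\<^sub>C" 75)
  assumes scaleC_add_right: "c *\<^sub>C (x + y) = c *\<^sub>C x + c *\<^sub>C y"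
    and scaleC_add_left: "(c + d) *\<^sub>C x = c *\<^sub>C x + d *\<^sub>C x"
    and scaleC_scaleC: "c *\<^sub>C d *\<^sub>C x = (c * d) *\<^sub>C x"
    and scaleC_of_real: "complex_of_real r *\<^sub>C x = r *\<^sub>R x"
    and norm_scaleC: "norm (c *\<^sub>C x) = cmod c * norm x"

class complex_hilbert = complex_banach +
  fixes cinner :: "'a \<Rightarrow> 'a \<Rightarrow> complex"
  assumes cinner_add_left: "cinner (x + y) z = cinner x z + cinner y z"
    and cinner_scaleC_left: "cinner (c *\<^sub>C x) y = c * cinner x y"
    and cinner_commute: "cinner y x = cnj (cinner x y)"
    and norm_eq_sqrt_cinner: "norm x = sqrt (Re (cinner x x))"

text \<open>C*-algebras need not have a unit.\<close>

class cstar_algebra = complex_banach + real_normed_algebra +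
  fixes star :: "'a \<Rightarrow> 'a"
  assumes mult_scaleC_left: "(c *\<^sub>C x) * y = c *\<^sub>C (x * y)"
    and mult_scaleC_right: "x * (c *\<^sub>C y) = c *\<^sub>C (x * y)"
    and star_star: "star (star x) = x"
    and star_add: "star (x + y) = star x + star y"
    and star_scaleC: "star (c *\<^sub>C x) = cnj c *\<^sub>C star x"
    and star_mult: "star (x * y) = star y * star x"
    and cstar_identity: "norm (star x * x) = (norm x)\<^sup>2"

definition positive :: "'a::cstar_algebra \<Rightarrow> bool" where
  "positive a \<longleftrightarrow> (\<exists>x. a = star x * x)"

definition csubspace :: "'a::complex_banach set \<Rightarrow> bool" where
  "csubspace I \<longleftrightarrow> subspace I \<and> (\<forall>c. \<forall>x\<in>I. c *\<^sub>C x \<in> I)"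

text \<open>Closed two-sided ideals of a C*-subalgebra \<open>B\<close> of the ambient algebra;
  the ambient algebra itself is \<open>UNIV\<close>.\<close>

definition closed_ideal :: "'a::cstar_algebra set \<Rightarrow> 'a set \<Rightarrow> bool" where
  "closed_ideal B I \<longleftrightarrow> I \<subseteq> B \<and> closed I \<and> csubspace I \<and>
     (\<forall>x\<in>I. \<forall>y\<in>B. x * y \<in> I \<and> y * x \<in> I)"

text \<open>The quotient \<open>I / J\<close> has underlying set \<open>coset J ` I\<close>, with the operations induced
  from representatives.\<close>

definition coset :: "'a::ab_group_add set \<Rightarrow> 'a \<Rightarrow> 'a set" where
  "coset J x = (\<lambda>j. x + j) ` J"

definition unital_quotient :: "'a::cstar_algebra set \<Rightarrow> 'a set \<Rightarrow> bool" where
  "unital_quotient B I \<longleftrightarrow>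
     (\<exists>u\<in>B. \<forall>x\<in>B. coset I (u * x) = coset I x \<and> coset I (x * u) = coset I x)"

definition soft_subalgebra :: "'a::cstar_algebra set \<Rightarrow> bool" where
  "soft_subalgebra B \<longleftrightarrow> (\<forall>I. closed_ideal B I \<and> I \<noteq> B \<longrightarrow> \<not> unital_quotient B I)"

definition hereditary_subalgebra :: "'a::cstar_algebra \<Rightarrow> 'a set" where
  "hereditary_subalgebra a = closure (range (\<lambda>x. a * x * a))"

definition soft :: "'a::cstar_algebra \<Rightarrow> bool" where
  "soft b \<longleftrightarrow> positive b \<and> soft_subalgebra (hereditary_subalgebra b)"

text \<open>The element \<open>p(a)\<close> for a polynomial \<open>p\<close> with \<open>p(0) = 0\<close>. As there is no unit, the power
  \<open>a\<^bsup>i+1\<^esup>\<close> is written as the \<open>i\<close>-fold multiplication by \<open>a\<close> applied to \<open>a\<close>.\<close>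

definition poly_at :: "real poly \<Rightarrow> 'a::cstar_algebra \<Rightarrow> 'a" where
  "poly_at p a = (\<Sum>i<degree p. coeff p (Suc i) *\<^sub>R (((*) a ^^ i) a))"

text \<open>Continuous functional calculus: \<open>c = f(a)\<close>, for \<open>a\<close> positive and \<open>f\<close> continuous on
  \<open>[0, \<parallel>a\<parallel>]\<close>, which contains the spectrum of \<open>a\<close>, with \<open>f(0) = 0\<close>. By definition \<open>f(a)\<close> is the
  limit of \<open>p\<^sub>n(a)\<close> for polynomials \<open>p\<^sub>n\<close> without constant term that converge uniformly to \<open>f\<close>;
  it always exists and does not depend on the sequence, since \<open>\<parallel>q(a)\<parallel> \<le> sup |q|\<close>.\<close>

definition has_functional_calculus ::
    "(real \<Rightarrow> real) \<Rightarrow> 'a::cstar_algebra \<Rightarrow> 'a \<Rightarrow> bool" where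
  "has_functional_calculus f a c \<longleftrightarrow>
     (\<exists>p. (\<forall>n. poly (p n) 0 = 0) \<and>
          uniform_limit {0..norm a} (\<lambda>n. poly (p n)) f sequentially \<and>
          (\<lambda>n. poly_at (p n) a) \<longlonglongrightarrow> c)"

text \<open>Below, \<open>c\<close> is the element \<open>(a - \<epsilon>)\<^sub>+\<close>.\<close>

definition abundance_of_soft_elements :: "'a::cstar_algebra itself \<Rightarrow> bool" where
  "abundance_of_soft_elements _ \<longleftrightarrow>
     (\<forall>(a::'a) \<epsilon>. positive a \<and> 0 < \<epsilon> \<longrightarrow>
        (\<exists>b c. soft b \<and> b \<in> hereditary_subalgebra a \<and>
               has_functional_calculus (\<lambda>t. max (t - \<epsilon>) 0) a c \<and>
               c \<in> closed_ideal UNIV hull {b}))"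

definition compact_operator :: "('h::complex_hilbert \<Rightarrow> 'h) \<Rightarrow> bool" where
  "compact_operator T \<longleftrightarrow>
     (\<forall>u v. T (u + v) = T u + T v) \<and> (\<forall>c u. T (c *\<^sub>C u) = c *\<^sub>C T u) \<and>
     compact (closure (T ` cball 0 1))"

text \<open>\<open>\<phi>\<close> is a *-isomorphism from \<open>I / J\<close> onto the algebra of compact operators on \<open>'h\<close>. The last
  clause says that \<open>\<phi>\<close> maps the adjoint of a coset to the adjoint operator.\<close>

definition quotient_iso_compacts ::
    "'a::cstar_algebra set \<Rightarrow> 'a set \<Rightarrow> ('a set \<Rightarrow> 'h::complex_hilbert \<Rightarrow> 'h) \<Rightarrow> bool" where
  "quotient_iso_compacts I J \<phi> \<longleftrightarrow>
     bij_betw \<phi> (coset J ` I) {T. compact_operator T} \<and>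
     (\<forall>x\<in>I. \<forall>y\<in>I. \<phi> (coset J (x + y)) = (\<lambda>v. \<phi> (coset J x) v + \<phi> (coset J y) v)) \<and>
     (\<forall>c. \<forall>x\<in>I. \<phi> (coset J (c *\<^sub>C x)) = (\<lambda>v. c *\<^sub>C \<phi> (coset J x) v)) \<and>
     (\<forall>x\<in>I. \<forall>y\<in>I. \<phi> (coset J (x * y)) = \<phi> (coset J x) \<circ> \<phi> (coset J y)) \<and>
     (\<forall>x\<in>I. \<forall>u v. cinner (\<phi> (coset J x) u) v = cinner u (\<phi> (coset J (star x)) v))"

text \<open>No ideal-quotient of \<open>'a\<close> is isomorphic to the compact operators on the Hilbert space \<open>'h\<close>,
  unless \<open>'h\<close> is zero. HOL cannot quantify over types inside a formula: \<open>'a\<close> is nowhere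
  scattered if this holds for every Hilbert space \<open>'h\<close>, so \<open>'h\<close> is to be left as a free type
  variable in the conclusion of a theorem.\<close>

definition nowhere_scattered_wrt ::
    "'h::complex_hilbert itself \<Rightarrow> 'a::cstar_algebra itself \<Rightarrow> bool" where
  "nowhere_scattered_wrt _ _ \<longleftrightarrow> ((\<exists>v::'h. v \<noteq> 0) \<longrightarrow>
     \<not> (\<exists>(I::'a set) J (\<phi>::'a set \<Rightarrow> 'h \<Rightarrow> 'h).
          closed_ideal UNIV I \<and> closed_ideal UNIV J \<and> J \<subseteq> I \<and> quotient_iso_compacts I J \<phi>))"

end

theory Submission
  imports Defs
begin

text \<open>For a strongly soft \<open>y\<close> and \<open>y' \<lless> y\<close>, pick \<open>t\<close> with \<open>y' + t \<lless> y\<close> and \<open>y' \<lless> \<infinity>t\<close>.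
  Applying (O6) to \<open>y' \<le> t + \<dots> + t\<close> splits \<open>y'\<close> approximately into summands \<open>e \<le> y', t\<close>, and
  \<open>2e \<le> y' + t \<le> y\<close>. Abundance transfers this to the elements of the scale, and (O6) to all
  elements of the ideal generated by the scale.

  The C*-algebraic part is proved without Cuntz semigroups. A rank-one projection in an
  ideal-quotient \<open>I / J\<close> isomorphic to the compact operators lifts to a positive \<open>e \<in> I\<close> that is
  modulo \<open>J\<close> a minimal projection. A soft \<open>b\<close> in the hereditary subalgebra of \<open>e\<close> is a multiple of
  \<open>e\<close> modulo \<open>J\<close>, and a nonzero multiple would give the hereditary subalgebra of \<open>b\<close> a unital
  (one-dimensional) quotient; so \<open>b \<in> J\<close>. Hence \<open>J\<close> contains \<open>(e - 1/2)\<^sub>+\<close>, which is \<open>e/2\<close> modulo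
  \<open>J\<close>, a contradiction.\<close>

section \<open>Cu-semigroups\<close>

context order
begin

lemma way_below_seq_supD:
  "x \<lless> y \<Longrightarrow> increasing_seq z \<Longrightarrow> seq_sup z s \<Longrightarrow> y \<le> s \<Longrightarrow> \<exists>n. x \<le> z n"
  unfolding way_below_def by blast

lemma way_below_imp_le: "x \<lless> y \<Longrightarrow> x \<le> y"
  using way_below_seq_supD[of x y "\<lambda>_. y" y] by (auto simp: increasing_seq_def seq_sup_def)

lemma le_way_below_trans: "x \<le> y \<Longrightarrow> y \<lless> z \<Longrightarrow> x \<lless> z"
  unfolding way_below_def by (meson order_trans)

lemma way_below_le_trans: "x \<lless> y \<Longrightarrow> y \<le> z \<Longrightarrow> x \<lless> z"
  unfolding way_below_def by (meson order_trans)

lemma seq_sup_unique: "seq_sup z s \<Longrightarrow> seq_sup z t \<Longrightarrow> s = t"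
  unfolding seq_sup_def by (meson order_antisym)

end

section \<open>Approximation and interpolation for the way-below relation\<close>

lemma cu_approximation:
  fixes x :: "'a::cu_semigroup"
  obtains z where "increasing_seq z" "seq_sup z x" "\<And>n. z n \<lless> z (Suc n)" "\<And>n. z n \<lless> x"
proof -
  obtain z where z: "\<forall>n. z n \<lless> z (Suc n)" "seq_sup z x"
    using Cu_O2 by blast
  then have "z n \<lless> x" for n
    by (meson seq_sup_def way_below_le_trans)
  moreover have "increasing_seq z"
    using z(1) by (simp add: increasing_seq_def way_below_imp_le)
  ultimately show thesis
    using z that by blast
qed

lemma way_below_interpolation:
  fixes x z :: "'a::cu_semigroup"
  assumes "x \<lless> z"
  obtains y where "x \<lless> y" "y \<lless> z"
proof -
  obtain w where w: "increasing_seq w" "seq_sup w z" "\<And>n. w n \<lless> w (Suc n)" "\<And>n. w n \<lless> z"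
    using cu_approximation[of z] by blast
  obtain n where "x \<le> w n"
    using way_below_seq_supD[OF assms w(1,2)] by blast
  then show thesis
    using that[of "w (Suc n)"] w(3,4) le_way_below_trans by blast
qed

text \<open>By (O4) the termwise sum of approximating sequences of \<open>y\<close> and
  \<open>z\<close> has supremum \<open>y + z\<close>, so one of its terms already dominates
  \<open>x\<close>.\<close>

lemma way_below_add_approx:
  fixes x y z :: "'a::cu_semigroup"
  assumes "x \<lless> y + z"
  obtains y' z' where "y' \<lless> y" "z' \<lless> z" "x \<le> y' + z'"
proof -
  obtain u where u: "increasing_seq u" "seq_sup u y" "\<And>n. u n \<lless> y"
    using cu_approximation[of y] by metis
  obtain v where v: "increasing_seq v" "seq_sup v z" "\<And>n. v n \<lless> z"
    using cu_approximation[of z] by metis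
  have "increasing_seq (\<lambda>n. u n + v n)"
    using u(1) v(1) by (simp add: increasing_seq_def add_mono)
  then obtain n where "x \<le> u n + v n"
    using way_below_seq_supD[OF assms _ Cu_O4[OF u(1) v(1) u(2) v(2)]] by blast
  then show thesis
    using that u(3) v(3) by blast
qed

lemma way_below_sum_list_approx:
  fixes ys :: "'a::cu_semigroup list"
  assumes "x \<lless> sum_list ys"
  obtains zs where "list_all2 (\<lless>) zs ys" "x \<le> sum_list zs"
  using assms
proof (induction ys arbitrary: x thesis)
  case Nil
  then show ?case
    using way_below_imp_le[of x 0] by (auto intro: Nil.prems(1)[of "[]"])
next
  case (Cons y ys)
  obtain y' z' where yz: "y' \<lless> y" "z' \<lless> sum_list ys" "x \<le> y' + z'"
    using way_below_add_approx[of x y "sum_list ys"] Cons.prems(2) by auto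
  obtain zs where "list_all2 (\<lless>) zs ys" "z' \<le> sum_list zs"
    using Cons.IH yz(2) by blast
  moreover from this have "x \<le> sum_list (y' # zs)"
    using yz(3) add_left_mono[of z' "sum_list zs" y'] by (simp add: order_trans)
  ultimately show ?case
    using Cons.prems(1)[of "y' # zs"] yz(1) by simp
qed

lemma seq_sup_infinite_multiple:
  fixes y :: "'a::cu_semigroup"
  shows "increasing_seq (\<lambda>n. \<Sum>i<n. y)" "seq_sup (\<lambda>n. \<Sum>i<n. y) (infinite_multiple y)"
proof -
  show inc: "increasing_seq (\<lambda>n. \<Sum>i<n. y)"
    unfolding increasing_seq_def by (auto simp: add_increasing2 Cu_zero_le)
  show "seq_sup (\<lambda>n. \<Sum>i<n. y) (infinite_multiple y)"
    unfolding infinite_multiple_def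
    using Cu_O1[OF inc] by (auto intro: theI seq_sup_unique)
qed

lemma way_below_infinite_multiple:
  fixes y :: "'a::cu_semigroup"
  assumes "x \<lless> z" "z \<le> infinite_multiple y"
  obtains n where "x \<le> sum_list (replicate n y)"
proof -
  obtain n :: nat where "x \<le> (\<Sum>i<n. y)"
    using way_below_seq_supD[OF assms(1) seq_sup_infinite_multiple assms(2)] by blast
  moreover have "(\<Sum>i<n. y) = sum_list (replicate n y)"
    by (induction n) (auto simp: add.commute)
  ultimately show thesis
    using that by simp
qed

section \<open>Splitting by (O6) and divisibility\<close>

text \<open>Induction on the list: (O6) splits off the head, and the induction hypothesis treats the
  remainder \<open>f\<close>.\<close>

lemma property_O6_sum_list:
  fixes x :: "'a::cu_semigroup"
  assumes "property_O6 TYPE('a)" "x' \<lless> x" "x \<le> sum_list ys"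
  obtains es where "list_all2 (\<le>) es ys" "\<forall>e\<in>set es. e \<le> x" "x' \<le> sum_list es"
  using assms(2,3)
proof (induction ys arbitrary: x' x thesis)
  case Nil
  then show ?case
    using way_below_imp_le[of x' x] by (auto intro: Nil.prems(1)[of "[]"])
next
  case (Cons y ys)
  \<comment> \<open>\<open>w\<close> is the element that (O6) covers; the gap
    \<open>x' \<lless> w\<close> then allows \<open>f\<close> to be shrunk to some
    \<open>f' \<lless> f\<close>, as the induction hypothesis requires.\<close>
  obtain w where w: "x' \<lless> w" "w \<lless> x"
    using way_below_interpolation[OF Cons.prems(2)] by blast
  have "x \<le> y + sum_list ys"
    using Cons.prems(3) by simp
  then obtain e f where ef: "e \<le> x" "e \<le> y" "f \<le> x" "f \<le> sum_list ys" "w \<le> e + f"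
    using assms(1) w(2) unfolding property_O6_def by blast
  obtain e' f' where ef': "e' \<lless> e" "f' \<lless> f" "x' \<le> e' + f'"
    using way_below_add_approx way_below_le_trans[OF w(1) ef(5)] by blast
  obtain es where es: "list_all2 (\<le>) es ys" "\<forall>e\<in>set es. e \<le> f" "f' \<le> sum_list es"
    using Cons.IH[OF _ ef'(2) ef(4)] by blast
  have "x' \<le> sum_list (e # es)"
    using ef'(3) add_mono[OF way_below_imp_le[OF ef'(1)] es(3)] by simp
  moreover have "\<forall>d\<in>set (e # es). d \<le> x"
    using ef(1,3) es(2) by auto
  ultimately show ?case
    using Cons.prems(1)[of "e # es"] ef(2) es(1) by simp
qed

lemma sum_list_le_sum_list_concat:
  fixes es :: "'a::cu_semigroup list"
  assumes "\<forall>e\<in>set es. \<exists>ys. e \<le> sum_list ys \<and> (\<forall>y\<in>set ys. P y)"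
  shows "\<exists>ys. sum_list es \<le> sum_list ys \<and> (\<forall>y\<in>set ys. P y)"
  using assms
proof (induction es)
  case Nil
  show ?case
    by (rule exI[of _ "[]"]) simp
next
  case (Cons e es)
  then obtain ys zs where "e \<le> sum_list ys" "\<forall>y\<in>set ys. P y"
    "sum_list es \<le> sum_list zs" "\<forall>y\<in>set zs. P y"
    by auto
  then show ?case
    by (intro exI[of _ "ys @ zs"]) (auto simp: add_mono)
qed

lemma strongly_soft_divisible:
  fixes y :: "'a::cu_semigroup"
  assumes O6: "property_O6 TYPE('a)" and "strongly_soft y" "y' \<lless> y"
  shows "\<exists>es. y' \<le> sum_list es \<and> (\<forall>e\<in>set es. e + e \<le> y)"
proof -
  \<comment> \<open>Softness is used at \<open>w\<close> instead of \<open>y'\<close>, so that the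
    gap \<open>y' \<lless> w\<close> remains for (O6). Pieces below both \<open>w\<close> and
    \<open>t\<close> satisfy \<open>e + e \<le> w + t \<le> y\<close>.\<close>
  obtain w where w: "y' \<lless> w" "w \<lless> y"
    using way_below_interpolation[OF assms(3)] by blast
  obtain t where t: "w + t \<lless> y" "w \<lless> infinite_multiple t"
    using assms(2) w(2) unfolding strongly_soft_def by blast
  obtain n where "w \<le> sum_list (replicate n t)"
    using way_below_infinite_multiple[OF t(2)] by blast
  then obtain es where es: "list_all2 (\<le>) es (replicate n t)" "\<forall>e\<in>set es. e \<le> w" "y' \<le> sum_list es"
    using property_O6_sum_list[OF O6 w(1)] by blast
  have "e + e \<le> y" if "e \<in> set es" for e
  proof -
    have "e \<le> t"
      using es(1) that by (auto simp: list_all2_conv_all_nth in_set_conv_nth)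
    then show ?thesis
      using es(2) that way_below_imp_le[OF t(1)] by (meson add_mono order_trans)
  qed
  then show ?thesis
    using es(3) by blast
qed

text \<open>Abundance gives a soft \<open>y \<le> x\<close>, finitely many copies of which suffice.
  Each copy is shrunk to some \<open>z \<lless> y\<close> and then divided; the doubled pieces stay
  below \<open>y \<le> x\<close>.\<close>

lemma scale_divisible:
  fixes x :: "'a::cu_semigroup"
  assumes O6: "property_O6 TYPE('a)" and "cu_hereditary \<Sigma>"
    and "abundance_of_strongly_soft_elements \<Sigma>" "x \<in> \<Sigma>" "x' \<lless> x"
  shows "\<exists>es. x' \<le> sum_list es \<and> (\<forall>e\<in>set es. e + e \<le> x)"
proof -
  \<comment> \<open>Each gap in \<open>x' \<lless> w \<lless> v \<lless> x\<close> is spent once: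
    the last on abundance, the middle one on reaching a finite multiple of \<open>y\<close>, the
    first on shrinking the copies of \<open>y\<close>.\<close>
  obtain v where v: "x' \<lless> v" "v \<lless> x"
    using way_below_interpolation[OF assms(5)] by blast
  obtain w where w: "x' \<lless> w" "w \<lless> v"
    using way_below_interpolation[OF v(1)] by blast
  have "v \<in> \<Sigma>"
    using assms(2,4) way_below_imp_le[OF v(2)] unfolding cu_hereditary_def by blast
  then obtain y where y: "strongly_soft y" "v \<le> infinite_multiple y" "y \<le> x"
    using assms(3,4) v(2) unfolding abundance_of_strongly_soft_elements_def by blast
  obtain n where "w \<le> sum_list (replicate n y)"
    using way_below_infinite_multiple[OF w(2) y(2)] by blast
  then obtain zs where zs: "list_all2 (\<lless>) zs (replicate n y)" "x' \<le> sum_list zs"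
    using way_below_sum_list_approx way_below_le_trans[OF w(1)] by blast
  have "\<forall>z\<in>set zs. \<exists>es. z \<le> sum_list es \<and> (\<forall>e\<in>set es. e + e \<le> x)"
  proof
    fix z assume "z \<in> set zs"
    then have "z \<lless> y"
      using zs(1) by (auto simp: list_all2_conv_all_nth in_set_conv_nth)
    then show "\<exists>es. z \<le> sum_list es \<and> (\<forall>e\<in>set es. e + e \<le> x)"
      using strongly_soft_divisible[OF O6 y(1)] y(3) by (meson order_trans)
  qed
  from sum_list_le_sum_list_concat[OF this] show ?thesis
    using zs(2) by (meson order_trans)
qed

text \<open>The elements all of whose way-below parts are dominated by finite sums from
  \<open>X\<close> form an ideal containing \<open>X\<close>, hence containing the hull.\<close>

lemma cu_ideal_hull_approx:
  fixes x :: "'a::cu_semigroup"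
  assumes "x \<in> cu_ideal hull X" "x' \<lless> x"
  shows "\<exists>ys. x' \<le> sum_list ys \<and> set ys \<subseteq> X"
proof -
  define I where "I = {x. \<forall>x'. x' \<lless> x \<longrightarrow> (\<exists>ys. x' \<le> sum_list ys \<and> set ys \<subseteq> X)}"
  have add: "x + y \<in> I" if xy: "x \<in> I" "y \<in> I" for x y
    unfolding I_def
  proof (intro CollectI allI impI)
    fix w assume "w \<lless> x + y"
    then obtain x' y' where w: "x' \<lless> x" "y' \<lless> y" "w \<le> x' + y'"
      using way_below_add_approx by blast
    then obtain xs ys where "x' \<le> sum_list xs" "set xs \<subseteq> X" "y' \<le> sum_list ys" "set ys \<subseteq> X"
      using xy unfolding I_def by blast
    then show "\<exists>ys. w \<le> sum_list ys \<and> set ys \<subseteq> X"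
      using w(3) by (intro exI[of _ "xs @ ys"]) (auto intro: order_trans add_mono)
  qed
  have "s \<in> I" if z: "increasing_seq z" "range z \<subseteq> I" "seq_sup z s" for z s
    unfolding I_def
  proof (intro CollectI allI impI)
    fix w assume "w \<lless> s"
    \<comment> \<open>The supremum property yields only \<open>v \<le> z n\<close>; the gap
      \<open>w \<lless> v\<close> turns this into \<open>w \<lless> z n\<close>.\<close>
    then obtain v where v: "w \<lless> v" "v \<lless> s"
      using way_below_interpolation by blast
    then obtain n where "v \<le> z n"
      using way_below_seq_supD z by blast
    then show "\<exists>ys. w \<le> sum_list ys \<and> set ys \<subseteq> X"
      using z(2) way_below_le_trans[OF v(1)] unfolding I_def by blast
  qed
  moreover have "0 \<in> I"
    unfolding I_def by (auto intro!: exI[of _ "[]"] dest: way_below_imp_le)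
  moreover have "cu_hereditary I"
    unfolding cu_hereditary_def I_def using way_below_le_trans by blast
  ultimately have "cu_ideal I"
    unfolding cu_ideal_def cu_sup_closed_def using add by blast
  moreover have "X \<subseteq> I"
  proof
    fix y assume "y \<in> X"
    then show "y \<in> I"
      unfolding I_def by (auto intro!: exI[of _ "[y]"] dest: way_below_imp_le)
  qed
  ultimately have "x \<in> I"
    using assms(1) hull_minimal by blast
  then show ?thesis
    using assms(2) unfolding I_def by blast
qed

theorem weakly_2_omega_divisible:
  fixes \<Sigma> :: "'a::cu_semigroup set"
  assumes "cu_scale \<Sigma>" and O6: "property_O6 TYPE('a)"
    and soft: "abundance_of_strongly_soft_elements \<Sigma>"
  shows "weakly_2_omega_divisible TYPE('a)"
  unfolding weakly_2_omega_divisible_def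
proof (intro allI impI)
  fix x' x :: 'a assume "x' \<lless> x"
  then obtain w where w: "x' \<lless> w" "w \<lless> x"
    using way_below_interpolation by blast
  obtain v where v: "x' \<lless> v" "v \<lless> w"
    using way_below_interpolation[OF w(1)] by blast
  have her: "cu_hereditary \<Sigma>" and gen: "x \<in> cu_ideal hull \<Sigma>"
    using assms(1) unfolding cu_scale_def by auto
  obtain ys where ys: "w \<le> sum_list ys" "set ys \<subseteq> \<Sigma>"
    using cu_ideal_hull_approx[OF gen w(2)] by blast
  \<comment> \<open>The members of \<open>ys\<close> need not lie below \<open>x\<close>. (O6) cuts
    them down to elements below \<open>w\<close>, hence below \<open>x\<close>, which stay in
    \<open>\<Sigma>\<close> by heredity.\<close>
  obtain es where es: "list_all2 (\<le>) es ys" "\<forall>e\<in>set es. e \<le> w" "v \<le> sum_list es"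
    using property_O6_sum_list[OF O6 v(2) ys(1)] by blast
  obtain zs where zs: "list_all2 (\<lless>) zs es" "x' \<le> sum_list zs"
    using way_below_sum_list_approx[OF way_below_le_trans[OF v(1) es(3)]] by blast
  have "\<forall>z\<in>set zs. \<exists>ds. z \<le> sum_list ds \<and> (\<forall>d\<in>set ds. d + d \<le> x)"
  proof
    fix z assume "z \<in> set zs"
    then obtain e where e: "z \<lless> e" "e \<in> set es"
      using zs(1) by (metis in_set_conv_nth list_all2_conv_all_nth)
    then obtain y where "e \<le> y" "y \<in> set ys"
      using es(1) by (metis in_set_conv_nth list_all2_conv_all_nth)
    then have "e \<in> \<Sigma>"
      using her ys(2) unfolding cu_hereditary_def by blast
    moreover have "e \<le> x"
      using es(2) e(2) way_below_imp_le[OF w(2)] order_trans by blast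
    ultimately show "\<exists>ds. z \<le> sum_list ds \<and> (\<forall>d\<in>set ds. d + d \<le> x)"
      using scale_divisible[OF O6 her soft _ e(1)] by (meson order_trans)
  qed
  from sum_list_le_sum_list_concat[OF this]
  show "\<exists>ys. x' \<le> sum_list ys \<and> (\<forall>y\<in>set ys. y + y \<le> x)"
    using zs(2) by (meson order_trans)
qed


section \<open>Closed ideals of C*-algebras\<close>

lemma scaleC_zero_right [simp]: "c *\<^sub>C (0::'a::complex_banach) = 0"
  using scaleC_add_right[of c 0 0] by simp

lemma scaleC_zero_left [simp]: "0 *\<^sub>C (x::'a::complex_banach) = 0"
  using scaleC_add_left[of 0 0 x] by simp

lemma scaleC_one [simp]: "1 *\<^sub>C (x::'a::complex_banach) = x"
  using scaleC_of_real[of 1 x] by simp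

lemma scaleC_minus_right: "c *\<^sub>C (- x) = - (c *\<^sub>C (x::'a::complex_banach))"
  using scaleC_add_right[of c x "- x"] by (simp add: eq_neg_iff_add_eq_0 add.commute)

lemma scaleC_minus_left: "(- c) *\<^sub>C x = - (c *\<^sub>C (x::'a::complex_banach))"
  using scaleC_add_left[of c "- c" x] by (simp add: eq_neg_iff_add_eq_0 add.commute)

lemma scaleC_diff_right: "c *\<^sub>C (x - y) = c *\<^sub>C x - c *\<^sub>C (y::'a::complex_banach)"
  using scaleC_add_right[of c x "- y"] by (simp add: scaleC_minus_right)

lemma star_minus: "star (- x) = - star (x::'a::cstar_algebra)"
  using star_scaleC[of "-1" x] by (simp add: scaleC_minus_left)

lemma star_diff: "star (x - y) = star x - star (y::'a::cstar_algebra)"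
  using star_add[of x "- y"] by (simp add: star_minus)

text \<open>The C*-identity and submultiplicativity give one inequality; the other is the same
  inequality for \<open>star x\<close>.\<close>

lemma norm_star: "norm (star x) = norm (x::'a::cstar_algebra)"
proof -
  have le: "norm y \<le> norm (star y)" for y :: 'a
  proof (cases "y = 0")
    case False
    have "norm y * norm y \<le> norm (star y) * norm y"
      using cstar_identity[of y] norm_mult_ineq[of "star y" y] by (simp add: power2_eq_square)
    then show ?thesis
      using False by simp
  qed simp
  show ?thesis
    using le[of x] le[of "star x"] by (simp add: star_star)
qed

lemma closed_ideal_UNIV_D:
  fixes J :: "'a::cstar_algebra set"
  assumes "closed_ideal UNIV J"
  shows "closed J" "0 \<in> J" "x \<in> J \<Longrightarrow> y \<in> J \<Longrightarrow> x + y \<in> J" "x \<in> J \<Longrightarrow> y \<in> J \<Longrightarrow> x - y \<in> J"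
    "x \<in> J \<Longrightarrow> r *\<^sub>R x \<in> J" "x \<in> J \<Longrightarrow> c *\<^sub>C x \<in> J" "x \<in> J \<Longrightarrow> x * z \<in> J" "x \<in> J \<Longrightarrow> z * x \<in> J"
  using assms unfolding closed_ideal_def csubspace_def
  by (auto simp: subspace_add subspace_0 subspace_diff subspace_scale)

section \<open>Quasi-resolvents of self-adjoint elements\<close>

text \<open>In the unitization the equation for \<open>g\<close> reads
  \<open>(1 + c h) g = h\<close>, so \<open>1 + (c + d) h = (1 + c h) (1 + d g)\<close>. It thus
  suffices to solve \<open>(1 + d g) x = g\<close>, which needs no unit as a fixed point problem for
  a contraction.\<close>

lemma quasi_resolvent_step:
  fixes h g :: "'a::cstar_algebra" and c d :: complex
  assumes g: "g = h - c *\<^sub>C (h * g)" and d: "cmod d * norm g < 1"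
  shows "\<exists>g'. g' = h - (c + d) *\<^sub>C (h * g')"
proof -
  have "\<exists>!x. g - d *\<^sub>C (g * x) = x"
  proof (rule banach_fix_type)
    show "\<forall>x y. dist (g - d *\<^sub>C (g * x)) (g - d *\<^sub>C (g * y)) \<le> (cmod d * norm g) * dist x y"
    proof (intro allI)
      fix x y :: 'a
      have "dist (g - d *\<^sub>C (g * x)) (g - d *\<^sub>C (g * y)) = norm (d *\<^sub>C (g * (y - x)))"
        by (simp add: dist_norm algebra_simps scaleC_diff_right)
      also have "\<dots> \<le> cmod d * (norm g * norm (y - x))"
        unfolding norm_scaleC by (intro mult_left_mono norm_mult_ineq) auto
      finally show "dist (g - d *\<^sub>C (g * x)) (g - d *\<^sub>C (g * y)) \<le> (cmod d * norm g) * dist x y"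
        by (simp add: dist_norm norm_minus_commute mult.assoc)
    qed
  qed (use d in auto)
  then obtain x where x: "x = g - d *\<^sub>C (g * x)"
    by metis
  have "h * x = h * g - d *\<^sub>C (h * g * x)"
    by (subst x) (simp add: algebra_simps mult_scaleC_right)
  then have "c *\<^sub>C (h * x) = c *\<^sub>C (h * g) - d *\<^sub>C ((c *\<^sub>C (h * g)) * x)"
    by (simp add: scaleC_diff_right scaleC_scaleC mult_scaleC_left mult.commute)
  moreover have "c *\<^sub>C (h * g) = h - g"
    using g by (simp add: algebra_simps)
  ultimately have "c *\<^sub>C (h * x) = h - g - d *\<^sub>C (h * x - g * x)"
    by (simp add: algebra_simps)
  then have "h - (c + d) *\<^sub>C (h * x) = g - d *\<^sub>C (g * x)"
    by (simp add: scaleC_add_left scaleC_diff_right algebra_simps)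
  then have "x = h - (c + d) *\<^sub>C (h * x)"
    using x by simp
  then show ?thesis
    by blast
qed

text \<open>Here \<open>g = h (1 + \<i>sh)\<^sup>-\<^sup>1\<close>, and \<open>1 - 2\<i>sg\<close> is the Cayley transform of \<open>h\<close>. It is unitary,
  which bounds \<open>g\<close>.\<close>

lemma quasi_resolvent_bound:
  fixes h g :: "'a::cstar_algebra" and s :: real
  assumes h: "star h = h" and s: "s > 0" and g: "g = h - (\<i> * of_real s) *\<^sub>C (h * g)"
  shows "norm g \<le> 1 / s"
proof -
  define c where "c = \<i> * complex_of_real s"
  have cnj: "cnj c = - c" and cmod: "cmod c = s"
    using s by (auto simp: c_def norm_mult)
  have g1: "g = h - c *\<^sub>C (h * g)"
    using g by (simp add: c_def)
  have g2: "star g = h + c *\<^sub>C (star g * h)"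
    by (subst g1) (simp add: star_diff star_scaleC star_mult h cnj scaleC_minus_left)
  have gg1: "star g * g = star g * h - c *\<^sub>C (star g * h * g)"
    by (subst (2) g1) (simp add: algebra_simps mult_scaleC_right)
  have gg2: "star g * g = h * g + c *\<^sub>C (star g * h * g)"
    by (subst g2) (simp add: algebra_simps mult_scaleC_left)
  have "2 *\<^sub>C (star g * g) = star g * g + star g * g"
    using scaleC_add_left[of 1 1 "star g * g"] by simp
  also have "\<dots> = star g * h + h * g"
    by (subst gg1, subst gg2) simp
  finally have "2 *\<^sub>C (star g * g) = star g * h + h * g" .
  moreover have "star g - g = c *\<^sub>C (star g * h + h * g)"
    by (subst g1, subst g2) (simp add: scaleC_add_right)
  \<comment> \<open>This is \<open>star (1 - 2 c g) (1 - 2 c g) = 1\<close> written without a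
    unit.\<close>
  ultimately have "star g - g = (2 * c) *\<^sub>C (star g * g)"
    by (simp add: mult.commute flip: scaleC_scaleC)
  then have "2 * s * (norm g)\<^sup>2 = norm (star g - g)"
    by (simp add: norm_scaleC cstar_identity norm_mult cmod)
  also have "\<dots> \<le> 2 * norm g"
    using norm_triangle_ineq4[of "star g" g] by (simp add: norm_star)
  finally have "s * norm g * norm g \<le> 1 * norm g"
    by (simp add: power2_eq_square)
  then have "s * norm g \<le> 1"
    by (cases "g = 0") (auto simp del: mult_1)
  then show ?thesis
    using s by (simp add: field_simps)
qed

text \<open>Continuation in the parameter: the bound \<open>norm g \<le> 1 / s\<close> permits a
  step of length \<open>s / 2\<close> from \<open>s\<close>, so \<open>s\<close> grows by the factor
  \<open>3/2\<close> each time and exceeds every \<open>M\<close>.\<close>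

lemma quasi_resolvent_exists:
  fixes h :: "'a::cstar_algebra"
  assumes h: "star h = h"
  obtains s g where "s > M" "s > 0" "g = h - (\<i> * of_real s) *\<^sub>C (h * g)"
proof -
  \<comment> \<open>Small enough that \<open>s0 * norm h < 1\<close>, so the first step can start at
    \<open>c = 0\<close> with \<open>g = h\<close>.\<close>
  define s0 where "s0 = 1 / (norm h + 1)"
  have s0: "s0 > 0"
    by (simp add: s0_def add_nonneg_pos)
  have ex: "\<exists>g. g = h - (\<i> * of_real (s0 * (3/2)^n)) *\<^sub>C (h * g)" for n
  proof (induction n)
    case 0
    have "s0 * norm h < 1"
      by (simp add: s0_def divide_simps add_nonneg_pos)
    then show ?case
      using quasi_resolvent_step[of h h 0 "\<i> * of_real s0"] s0 by (simp add: norm_mult)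
  next
    case (Suc n)
    define s where "s = s0 * (3/2)^n"
    have s: "s > 0"
      using s0 by (simp add: s_def)
    obtain g where g: "g = h - (\<i> * of_real s) *\<^sub>C (h * g)"
      using Suc unfolding s_def by blast
    have "norm g \<le> 1 / s"
      by (rule quasi_resolvent_bound[OF h s g])
    then have "cmod (\<i> * of_real (s / 2)) * norm g < 1"
      using s by (simp add: norm_mult field_simps)
    from quasi_resolvent_step[OF g this]
    have "\<exists>g'. g' = h - (\<i> * of_real s + \<i> * of_real (s / 2)) *\<^sub>C (h * g')" .
    moreover have "\<i> * of_real s + \<i> * of_real (s / 2) = \<i> * complex_of_real (s0 * (3/2)^Suc n)"
      by (simp add: s_def complex_eq_iff)
    ultimately show ?case
      by (simp only:)
  qed
  obtain n where "M / s0 < (3/2)^n"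
    using real_arch_pow[of "3/2"] by auto
  then have "s0 * (3/2)^n > M" "s0 * (3/2)^n > 0"
    using s0 by (auto simp: field_simps)
  then show thesis
    using that ex by blast
qed

text \<open>For the quasi-resolvent \<open>g\<close> of \<open>star z * z\<close>, the elements
  \<open>c z g\<close> lie in \<open>J\<close> and approximate \<open>z\<close> with squared error
  at most \<open>2 / s\<close>. They take the place of an approximate unit.\<close>

lemma closed_ideal_star_mult_cancel:
  fixes z :: "'a::cstar_algebra"
  assumes J: "closed_ideal UNIV J" and zz: "star z * z \<in> J"
  shows "z \<in> J"
proof -
  define h where "h = star z * z"
  have h: "star h = h"
    by (simp add: h_def star_mult star_star)
  have "\<exists>y\<in>J. dist y z < \<epsilon>" if "\<epsilon> > 0" for \<epsilon>
  proof -
    obtain s g where s: "s > 2 / \<epsilon>\<^sup>2" "s > 0" and g: "g = h - (\<i> * of_real s) *\<^sub>C (h * g)"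
      using quasi_resolvent_exists[OF h] by metis
    define c where "c = \<i> * complex_of_real s"
    have cnj: "cnj c = - c" and cmod: "cmod c = s"
      using s by (auto simp: c_def norm_mult)
    have gc: "h - c *\<^sub>C (h * g) = g"
      using g by (simp add: c_def)
    have "h - c *\<^sub>C (h * g) \<in> J"
      using zz closed_ideal_UNIV_D[OF J] by (auto simp: h_def)
    then have "g \<in> J"
      by (simp add: gc)
    then have y: "c *\<^sub>C (z * g) \<in> J"
      using closed_ideal_UNIV_D[OF J] by auto
    define r where "r = z - c *\<^sub>C (z * g)"
    \<comment> \<open>Grouped so that \<open>h - c h g\<close>, which equals \<open>g\<close>,
      occurs twice.\<close>
    have "star r * r = (h - c *\<^sub>C (h * g)) + c *\<^sub>C (star g * (h - c *\<^sub>C (h * g)))"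
      unfolding r_def h_def
      by (simp add: star_diff star_scaleC star_mult cnj scaleC_minus_left scaleC_minus_right
          algebra_simps mult_scaleC_left mult_scaleC_right scaleC_diff_right scaleC_add_right)
    then have "star r * r = g + c *\<^sub>C (star g * g)"
      by (simp add: gc)
    then have "(norm r)\<^sup>2 \<le> norm g + s * (norm g)\<^sup>2"
      using norm_triangle_ineq[of g "c *\<^sub>C (star g * g)"] cstar_identity[of r]
      by (simp add: norm_scaleC cmod cstar_identity)
    also have "\<dots> \<le> 1 / s + s * (1 / s)\<^sup>2"
      using quasi_resolvent_bound[OF h s(2) g] s(2)
      by (intro add_mono mult_left_mono power_mono) auto
    also have "\<dots> = 2 / s"
      using s(2) by (simp add: power2_eq_square)
    also have "\<dots> < \<epsilon>\<^sup>2"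
      using s that by (simp add: field_simps)
    finally have "norm r < \<epsilon>"
      using that by (simp add: power2_less_imp_less)
    then show ?thesis
      using y by (intro bexI[of _ "c *\<^sub>C (z * g)"]) (auto simp: r_def dist_norm norm_minus_commute)
  qed
  then show ?thesis
    using closed_ideal_UNIV_D(1)[OF J] closed_approachable by blast
qed

text \<open>The cancellation applies to \<open>z = star x\<close>, since
  \<open>star z * z = x * star x\<close> lies in \<open>J\<close>.\<close>

lemma closed_ideal_star:
  assumes "closed_ideal UNIV J" "x \<in> J"
  shows "star x \<in> J"
  using closed_ideal_star_mult_cancel[of J "star x"] closed_ideal_UNIV_D[OF assms(1)] assms
  by (simp add: star_star)

section \<open>Idempotents modulo a closed ideal\<close>

text \<open>Modulo \<open>J\<close> every power of \<open>e\<close> is \<open>e\<close>, so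
  \<open>p(e)\<close> collapses to the sum of the coefficients, which is \<open>p(1)\<close>, times
  \<open>e\<close>.\<close>

lemma poly_at_idempotent_mod_ideal:
  fixes e :: "'a::cstar_algebra"
  assumes J: "closed_ideal UNIV J" and e: "e * e - e \<in> J" and p: "poly p 0 = 0"
  shows "poly_at p e - poly p 1 *\<^sub>R e \<in> J"
proof -
  have pow: "((*) e ^^ i) e - e \<in> J" for i
  proof (induction i)
    case (Suc i)
    have "((*) e ^^ Suc i) e - e = e * (((*) e ^^ i) e - e) + (e * e - e)"
      by (simp add: algebra_simps)
    then show ?case
      using Suc e closed_ideal_UNIV_D[OF J] by metis
  qed (simp add: closed_ideal_UNIV_D[OF J])
  have "poly p 1 = (\<Sum>i\<le>degree p. coeff p i)"
    by (simp add: poly_altdef)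
  also have "\<dots> = coeff p 0 + (\<Sum>i<degree p. coeff p (Suc i))"
    by (rule sum.atMost_shift)
  also have "coeff p 0 = 0"
    using p by (simp add: poly_0_coeff_0)
  finally have "poly_at p e - poly p 1 *\<^sub>R e
      = (\<Sum>i<degree p. coeff p (Suc i) *\<^sub>R (((*) e ^^ i) e - e))"
    by (simp add: poly_at_def scaleR_sum_left sum_subtractf scaleR_diff_right)
  also have "\<dots> \<in> J"
    using J pow closed_ideal_UNIV_D(5)[OF J]
    by (intro subspace_sum) (auto simp: closed_ideal_def csubspace_def)
  finally show ?thesis .
qed

text \<open>If \<open>norm e < 1\<close>, the powers of \<open>e\<close> tend to \<open>0\<close>,
  yet all are congruent to \<open>e\<close> modulo the closed \<open>J\<close>. The bound puts
  \<open>1\<close> into \<open>{0..norm e}\<close>, where the functional calculus sees it.\<close>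

lemma norm_ge_1_if_idempotent_mod_ideal:
  fixes e :: "'a::cstar_algebra"
  assumes J: "closed_ideal UNIV J" and e: "e * e - e \<in> J" "e \<notin> J"
  shows "norm e \<ge> 1"
proof (rule ccontr)
  assume *: "\<not> norm e \<ge> 1"
  have bound: "norm (((*) e ^^ i) e) \<le> norm e ^ i * norm e" for i
  proof (induction i)
    case (Suc i)
    have "norm (((*) e ^^ Suc i) e) \<le> norm e * norm (((*) e ^^ i) e)"
      by (simp add: norm_mult_ineq)
    also have "\<dots> \<le> norm e * (norm e ^ i * norm e)"
      using Suc by (intro mult_left_mono) auto
    finally show ?case by (simp add: mult.assoc)
  qed simp
  have "(\<lambda>i. norm e ^ i * norm e) \<longlonglongrightarrow> 0"
    using * by (intro tendsto_mult_left_zero LIMSEQ_power_zero) auto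
  then have "(\<lambda>i. ((*) e ^^ i) e) \<longlonglongrightarrow> 0"
    by (rule Lim_null_comparison[rotated]) (simp add: bound)
  then have "(\<lambda>i. e - ((*) e ^^ i) e) \<longlonglongrightarrow> e - 0"
    by (intro tendsto_intros)
  moreover have "e - ((*) e ^^ i) e \<in> J" for i
  proof (induction i)
    case (Suc i)
    have "e - ((*) e ^^ Suc i) e = e * (e - ((*) e ^^ i) e) - (e * e - e)"
      by (simp add: algebra_simps)
    then show ?case
      using Suc e closed_ideal_UNIV_D[OF J] by metis
  qed (simp add: closed_ideal_UNIV_D[OF J])
  ultimately have "e - 0 \<in> J"
    by (rule closed_sequentially[OF closed_ideal_UNIV_D(1)[OF J], rotated])
  then show False
    using e by simp
qed

section \<open>Hereditary subalgebras and cosets\<close>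

lemma hereditary_subalgebra_mult:
  fixes b :: "'a::cstar_algebra"
  assumes "x \<in> hereditary_subalgebra b" "y \<in> hereditary_subalgebra b"
  shows "x * y \<in> hereditary_subalgebra b"
proof -
  obtain f where f: "\<And>n. f n \<in> range (\<lambda>x. b * x * b)" "f \<longlonglongrightarrow> x"
    using assms(1) unfolding hereditary_subalgebra_def closure_sequential by blast
  obtain g where g: "\<And>n. g n \<in> range (\<lambda>x. b * x * b)" "g \<longlonglongrightarrow> y"
    using assms(2) unfolding hereditary_subalgebra_def closure_sequential by blast
  have "f n * g n \<in> range (\<lambda>x. b * x * b)" for n
  proof -
    obtain u v where "f n = b * u * b" "g n = b * v * b"
      using f(1) g(1) by blast
    then have "f n * g n = b * (u * b * b * v) * b"
      by (simp add: mult.assoc)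
    then show ?thesis
      by blast
  qed
  moreover have "(\<lambda>n. f n * g n) \<longlonglongrightarrow> x * y"
    by (intro tendsto_intros f g)
  ultimately show ?thesis
    unfolding hereditary_subalgebra_def closure_sequential
    by (intro exI[of _ "\<lambda>n. f n * g n"]) simp
qed

lemma bounded_linear_scaleC_right: "bounded_linear (\<lambda>x::'a::complex_banach. c *\<^sub>C x)"
  by (rule bounded_linear_intro[of _ "cmod c"])
    (simp_all add: scaleC_add_right norm_scaleC scaleC_scaleC mult.commute flip: scaleC_of_real)

lemma csubspace_closure:
  fixes S :: "'a::complex_banach set"
  assumes S: "csubspace S"
  shows "csubspace (closure S)"
proof -
  have add: "x + y \<in> closure S" if "x \<in> closure S" "y \<in> closure S" for x y
  proof -
    obtain f g where "\<And>n. f n \<in> S" "f \<longlonglongrightarrow> x" "\<And>n. g n \<in> S" "g \<longlonglongrightarrow> y"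
      using \<open>x \<in> closure S\<close> \<open>y \<in> closure S\<close> unfolding closure_sequential by blast
    then show ?thesis
      using S unfolding closure_sequential csubspace_def
      by (intro exI[of _ "\<lambda>n. f n + g n"]) (auto intro: tendsto_add subspace_add)
  qed
  have scale: "c *\<^sub>C x \<in> closure S" if x: "x \<in> closure S" for c x
  proof -
    obtain f where "\<And>n. f n \<in> S" "f \<longlonglongrightarrow> x"
      using x unfolding closure_sequential by blast
    then show ?thesis
      using S unfolding closure_sequential csubspace_def
      by (intro exI[of _ "\<lambda>n. c *\<^sub>C f n"])
        (auto intro: bounded_linear.tendsto[OF bounded_linear_scaleC_right])
  qed
  have "r *\<^sub>R x \<in> closure S" if "x \<in> closure S" for r x
    using scale[OF that, of "of_real r"] by (simp add: scaleC_of_real)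
  moreover have "0 \<in> closure S"
    using S by (intro subsetD[OF closure_subset]) (auto simp: csubspace_def subspace_0)
  ultimately show ?thesis
    using add scale unfolding csubspace_def subspace_def by blast
qed

lemma csubspace_hereditary_subalgebra:
  fixes b :: "'a::cstar_algebra"
  shows "csubspace (hereditary_subalgebra b)"
proof -
  have "linear (\<lambda>x. b * x * b)"
    by (rule linearI) (simp_all add: algebra_simps)
  then have "subspace (range (\<lambda>x. b * x * b))"
    by (rule linear_subspace_image) simp
  moreover have "c *\<^sub>C (b * x * b) = b * (c *\<^sub>C x) * b" for c x
    by (simp add: mult_scaleC_left mult_scaleC_right)
  ultimately have "csubspace (range (\<lambda>x. b * x * b))"
    unfolding csubspace_def by auto
  then show ?thesis
    unfolding hereditary_subalgebra_def by (rule csubspace_closure)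
qed

lemma coset_eq_iff:
  assumes "subspace J"
  shows "coset J x = coset J y \<longleftrightarrow> x - y \<in> J"
proof
  assume "coset J x = coset J y"
  moreover have "x \<in> coset J x"
    unfolding coset_def using subspace_0[OF assms] by (auto intro: image_eqI[of _ _ 0])
  ultimately show "x - y \<in> J"
    unfolding coset_def by auto
next
  have sub: "coset J x \<subseteq> coset J y" if "x - y \<in> J" for x y
  proof
    fix z assume "z \<in> coset J x"
    then obtain j where "j \<in> J" "z = x + j"
      unfolding coset_def by blast
    then have "z = y + ((x - y) + j)" "(x - y) + j \<in> J"
      using that subspace_add[OF assms] by auto
    then show "z \<in> coset J y"
      unfolding coset_def by blast
  qed
  assume "x - y \<in> J"
  moreover from this have "y - x \<in> J"
    using subspace_neg[OF assms] by fastforce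
  ultimately show "coset J x = coset J y"
    using sub by blast
qed

section \<open>Soft elements below a minimal projection modulo an ideal\<close>

lemma soft_in_ideal:
  fixes b e :: "'a::cstar_algebra"
  assumes J: "closed_ideal UNIV J" and e: "e * e - e \<in> J"
    and min: "\<And>x. \<exists>c. e * x * e - c *\<^sub>C e \<in> J"
    and b: "b \<in> hereditary_subalgebra e" "soft_subalgebra (hereditary_subalgebra b)"
  shows "b \<in> J"
proof (rule ccontr)
  assume bJ: "b \<notin> J"
  note D = closed_ideal_UNIV_D[OF J]
  \<comment> \<open>Acting as a two-sided unit modulo \<open>J\<close> is a closed condition, so it
    need only be checked on a dense part of a hereditary subalgebra. It is used below for
    \<open>e\<close> and for the unit of the quotient of \<open>B\<close>.\<close>
  have cont: "closed {x. u * x - x \<in> J \<and> x * u - x \<in> J}" for u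
    by (intro closed_Collect_conj closed_vimage[OF D(1), unfolded vimage_def] continuous_intros)
  have "hereditary_subalgebra e \<subseteq> {x. e * x - x \<in> J \<and> x * e - x \<in> J}"
    unfolding hereditary_subalgebra_def
  proof (rule closure_minimal[OF _ cont], safe)
    fix x :: 'a
    have "e * (e * x * e) - e * x * e = (e * e - e) * (x * e)"
      by (simp add: algebra_simps)
    then show "e * (e * x * e) - e * x * e \<in> J"
      using D(7) e by metis
    have "e * x * e * e - e * x * e = (e * x) * (e * e - e)"
      by (simp add: algebra_simps)
    then show "e * x * e * e - e * x * e \<in> J"
      using D(8) e by metis
  qed
  then have eb: "e * b - b \<in> J" "b * e - b \<in> J"
    using b(1) by auto
  obtain \<mu> where \<mu>: "e * b * e - \<mu> *\<^sub>C e \<in> J"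
    using min by blast
  have "b - \<mu> *\<^sub>C e = (e * b * e - \<mu> *\<^sub>C e) - (e * b - b) * e - (b * e - b)"
    by (simp add: algebra_simps)
  then have b\<mu>: "b - \<mu> *\<^sub>C e \<in> J"
    using \<mu> eb D(4,7) by metis
  have "\<mu> \<noteq> 0"
    using b\<mu> bJ by auto
  \<comment> \<open>Modulo \<open>J\<close> one has \<open>b * b = \<mu> b\<close>, so
    \<open>u\<close> is congruent to the idempotent \<open>b / \<mu>\<close>. The cube is taken
    because \<open>b * b * b\<close> visibly has the form \<open>b * x * b\<close>.\<close>
  define u where "u = inverse (\<mu> ^ 3) *\<^sub>C (b * b * b)"
  define B where "B = hereditary_subalgebra b"
  have subB: "csubspace B" and multB: "\<And>x y. x \<in> B \<Longrightarrow> y \<in> B \<Longrightarrow> x * y \<in> B"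
    unfolding B_def by (simp_all add: csubspace_hereditary_subalgebra hereditary_subalgebra_mult)
  have "b * b * b \<in> B"
    unfolding B_def hereditary_subalgebra_def by (rule subsetD[OF closure_subset rangeI])
  then have uB: "u \<in> B"
    using subB unfolding csubspace_def u_def by blast
  have bb: "b * b - \<mu> *\<^sub>C b \<in> J"
  proof -
    have "b * b - \<mu> *\<^sub>C b = (b - \<mu> *\<^sub>C e) * b + \<mu> *\<^sub>C (e * b - b)"
      by (simp add: algebra_simps mult_scaleC_left scaleC_diff_right)
    then show ?thesis
      using b\<mu> eb D(3,6,7) by metis
  qed
  have bbb: "b * b * b - (\<mu> ^ 2) *\<^sub>C b \<in> J"
  proof -
    have "b * b * b - (\<mu> ^ 2) *\<^sub>C b = (b * b - \<mu> *\<^sub>C b) * b + \<mu> *\<^sub>C (b * b - \<mu> *\<^sub>C b)"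
      by (simp add: algebra_simps mult_scaleC_left scaleC_diff_right scaleC_scaleC power2_eq_square)
    then show ?thesis
      using bb D(3,6,7) by metis
  qed
  have "u - inverse \<mu> *\<^sub>C b = inverse (\<mu> ^ 3) *\<^sub>C (b * b * b - (\<mu> ^ 2) *\<^sub>C b)"
    using \<open>\<mu> \<noteq> 0\<close> by (simp add: u_def scaleC_diff_right scaleC_scaleC field_simps eval_nat_numeral)
  then have ub: "u - inverse \<mu> *\<^sub>C b \<in> J"
    using bbb D(6) by metis
  have u1: "u * b - b \<in> J" "b * u - b \<in> J"
  proof -
    have "u * b - b = (u - inverse \<mu> *\<^sub>C b) * b + inverse \<mu> *\<^sub>C (b * b - \<mu> *\<^sub>C b)"
      using \<open>\<mu> \<noteq> 0\<close> by (simp add: algebra_simps mult_scaleC_left scaleC_diff_right scaleC_scaleC)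
    then show "u * b - b \<in> J"
      using bb ub D(3,6,7) by metis
    have "b * u - b = b * (u - inverse \<mu> *\<^sub>C b) + inverse \<mu> *\<^sub>C (b * b - \<mu> *\<^sub>C b)"
      using \<open>\<mu> \<noteq> 0\<close> by (simp add: algebra_simps mult_scaleC_right scaleC_diff_right scaleC_scaleC)
    then show "b * u - b \<in> J"
      using bb ub D(3,6,8) by metis
  qed
  have unit: "B \<subseteq> {x. u * x - x \<in> J \<and> x * u - x \<in> J}"
    unfolding B_def hereditary_subalgebra_def
  proof (rule closure_minimal[OF _ cont], safe)
    fix x :: 'a
    have "u * (b * x * b) - b * x * b = (u * b - b) * (x * b)"
      by (simp add: algebra_simps)
    then show "u * (b * x * b) - b * x * b \<in> J"
      using D(7) u1 by metis
    have "b * x * b * u - b * x * b = (b * x) * (b * u - b)"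
      by (simp add: algebra_simps)
    then show "b * x * b * u - b * x * b \<in> J"
      using D(8) u1 by metis
  qed
  have subJ: "csubspace J"
    using J unfolding closed_ideal_def by blast
  have sub: "subspace (B \<inter> J)"
    using subB subJ by (auto simp: csubspace_def intro: subspace_inter)
  have "closed_ideal B (B \<inter> J)"
    unfolding closed_ideal_def
    using sub subB subJ multB D
    by (auto simp: csubspace_def B_def hereditary_subalgebra_def intro: closed_Int)
  \<comment> \<open>Otherwise \<open>u\<close> lies in \<open>J\<close>, hence so does
    \<open>u * b\<close>, which is congruent to \<open>b\<close>.\<close>
  moreover have "B \<inter> J \<noteq> B"
  proof
    assume "B \<inter> J = B"
    then have "u \<in> J"
      using uB by blast
    then have "u * b - (u * b - b) \<in> J"
      by (intro D(4) D(7) u1(1))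
    then show False
      using bJ by simp
  qed
  moreover have "unital_quotient B (B \<inter> J)"
    unfolding unital_quotient_def
  proof (intro bexI[OF _ uB] ballI)
    fix x assume x: "x \<in> B"
    have "u * x \<in> B" "x * u \<in> B"
      using multB uB x by auto
    then have "u * x - x \<in> B \<inter> J" "x * u - x \<in> B \<inter> J"
      using unit x subB subspace_diff by (auto simp: csubspace_def)
    then show "coset (B \<inter> J) (u * x) = coset (B \<inter> J) x \<and> coset (B \<inter> J) (x * u) = coset (B \<inter> J) x"
      by (simp add: coset_eq_iff[OF sub])
  qed
  ultimately show False
    using b(2) unfolding soft_subalgebra_def B_def by blast
qed

lemma not_abundance_of_soft_elements:
  fixes e :: "'a::cstar_algebra"
  assumes J: "closed_ideal UNIV J" and e: "positive e" "e * e - e \<in> J" "e \<notin> J"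
    and min: "\<And>x. \<exists>c. e * x * e - c *\<^sub>C e \<in> J"
  shows "\<not> abundance_of_soft_elements TYPE('a)"
proof
  assume "abundance_of_soft_elements TYPE('a)"
  moreover have "(0::real) < 1/2"
    by simp
  ultimately obtain b c where bc: "soft b" "b \<in> hereditary_subalgebra e"
      "has_functional_calculus (\<lambda>t. max (t - 1/2) 0) e c" "c \<in> closed_ideal UNIV hull {b}"
    using e(1) unfolding abundance_of_soft_elements_def by blast
  have "b \<in> J"
    using soft_in_ideal[OF J e(2) min bc(2)] bc(1) unfolding soft_def by blast
  then have "closed_ideal UNIV hull {b} \<subseteq> J"
    by (intro hull_minimal J) auto
  then have c: "c \<in> J"
    using bc(4) by blast
  obtain p where p: "\<And>n. poly (p n) 0 = 0"
      "uniform_limit {0..norm e} (\<lambda>n. poly (p n)) (\<lambda>t. max (t - 1/2) 0) sequentially"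
      "(\<lambda>n. poly_at (p n) e) \<longlonglongrightarrow> c"
    using bc(3) unfolding has_functional_calculus_def by blast
  \<comment> \<open>Since \<open>1\<close> lies in \<open>{0..norm e}\<close>, the uniform limit can
    be read off at \<open>1\<close>, where the cut-off function is \<open>1/2\<close>; thus
    \<open>c\<close> is congruent to \<open>e / 2\<close>.\<close>
  have "(\<lambda>n. poly (p n) 1) \<longlonglongrightarrow> max (1 - 1/2) 0"
    using norm_ge_1_if_idempotent_mod_ideal[OF J e(2,3)] by (intro tendsto_uniform_limitI[OF p(2)]) auto
  then have "(\<lambda>n. poly_at (p n) e - poly (p n) 1 *\<^sub>R e) \<longlonglongrightarrow> c - (1/2) *\<^sub>R e"
    by (intro tendsto_intros p(3)) simp
  then have "c - (1/2) *\<^sub>R e \<in> J"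
    by (rule closed_sequentially[OF closed_ideal_UNIV_D(1)[OF J], rotated])
      (rule poly_at_idempotent_mod_ideal[OF J e(2) p(1)])
  then have "2 *\<^sub>R (c - (c - (1/2) *\<^sub>R e)) \<in> J"
    using c closed_ideal_UNIV_D[OF J] by blast
  then show False
    using e(3) by simp
qed


section \<open>Rank-one projections\<close>

lemma cinner_minus_left: "cinner (- x) y = - cinner (x::'a::complex_hilbert) y"
  using cinner_scaleC_left[of "-1" x y] by (simp add: scaleC_minus_left)

lemma cinner_diff_left: "cinner (x - z) y = cinner (x::'a::complex_hilbert) y - cinner z y"
  using cinner_add_left[of x "- z" y] by (simp add: cinner_minus_left)

lemma cinner_diff_right: "cinner y (x - z) = cinner (y::'a::complex_hilbert) x - cinner y z"
  by (metis cinner_commute cinner_diff_left complex_cnj_diff)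

lemma cinner_scaleC_right: "cinner y (c *\<^sub>C x) = cnj c * cinner (y::'a::complex_hilbert) x"
  by (metis cinner_commute cinner_scaleC_left complex_cnj_mult)

lemma cinner_self: "cinner x x = of_real ((norm (x::'a::complex_hilbert))\<^sup>2)"
proof -
  \<comment> \<open>\<open>sqrt\<close> takes negative values at negative reals, so nonnegativity of
    \<open>Re (cinner x x)\<close> is drawn from that of the norm.\<close>
  have "sqrt (Re (cinner x x)) \<ge> 0"
    using norm_ge_zero[of x] unfolding norm_eq_sqrt_cinner .
  then have "(norm x)\<^sup>2 = Re (cinner x x)"
    unfolding norm_eq_sqrt_cinner[of x] by simp
  moreover have "Im (cinner x x) = 0"
    using cinner_commute[of x x] by (metis cnj.simps(2) eq_neg_iff_add_eq_0 add.commute mult_2 mult_eq_0_iff zero_neq_numeral)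
  ultimately show ?thesis
    by (simp add: complex_eq_iff)
qed

text \<open>Pythagoras: removing from \<open>u\<close> its component along \<open>v\<close> leaves a
  vector of squared norm \<open>|u|^2 - |c|^2\<close>.\<close>

lemma cinner_unit_bound:
  fixes u v :: "'a::complex_hilbert"
  assumes v: "norm v = 1"
  shows "cmod (cinner u v) \<le> norm u"
proof -
  define c where "c = cinner u v"
  have "of_real ((norm (u - c *\<^sub>C v))\<^sup>2) = cinner (u - c *\<^sub>C v) (u - c *\<^sub>C v)"
    by (simp add: cinner_self)
  also have "\<dots> = cinner u u - c * cnj c"
    using cinner_self[of v] v
    by (simp add: cinner_diff_left cinner_diff_right cinner_scaleC_left cinner_scaleC_right
        c_def cinner_commute[of v u] algebra_simps)
  also have "\<dots> = of_real ((norm u)\<^sup>2 - (cmod c)\<^sup>2)"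
    by (simp only: cinner_self complex_mult_cnj cmod_power2 of_real_diff)
  finally have "(norm (u - c *\<^sub>C v))\<^sup>2 = (norm u)\<^sup>2 - (cmod c)\<^sup>2"
    by (simp only: of_real_eq_iff)
  then have "(cmod c)\<^sup>2 \<le> (norm u)\<^sup>2"
    using zero_le_power2[of "norm (u - c *\<^sub>C v)"] by linarith
  then show ?thesis
    unfolding c_def by (rule power2_le_imp_le) simp
qed

lemma cinner_right_eqI:
  assumes "\<And>u. cinner u x = cinner u (y::'a::complex_hilbert)"
  shows "x = y"
proof -
  have "cinner (x - y) (x - y) = 0"
    using assms[of "x - y"] by (simp add: cinner_diff_right)
  then show ?thesis
    by (simp add: cinner_self)
qed

text \<open>The unit ball is mapped into the compact disc of all \<open>c v\<close> with
  \<open>|c| \<le> 1\<close>.\<close>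

lemma compact_operator_rank_one:
  fixes v :: "'a::complex_hilbert"
  assumes v: "norm v = 1"
  shows "compact_operator (\<lambda>u. cinner u v *\<^sub>C v)"
proof -
  have lin: "bounded_linear (\<lambda>c. c *\<^sub>C v)"
    by (rule bounded_linear_intro[of _ 1])
      (simp_all add: v scaleC_add_left norm_scaleC scaleC_scaleC scaleR_conv_of_real flip: scaleC_of_real)
  have cpt: "compact ((\<lambda>c. c *\<^sub>C v) ` cball 0 1)"
    by (intro compact_continuous_image compact_cball linear_continuous_on lin)
  have "(\<lambda>u. cinner u v *\<^sub>C v) ` cball 0 1 \<subseteq> (\<lambda>c. c *\<^sub>C v) ` cball 0 1"
    using order_trans[OF cinner_unit_bound[OF v]] by auto
  then have "closure ((\<lambda>u. cinner u v *\<^sub>C v) ` cball 0 1) \<subseteq> (\<lambda>c. c *\<^sub>C v) ` cball 0 1"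
    by (intro closure_minimal compact_imp_closed cpt)
  then have "compact (closure ((\<lambda>u. cinner u v *\<^sub>C v) ` cball 0 1))"
    using compact_Int_closed[OF cpt closed_closure] by (metis Int_absorb1)
  then show ?thesis
    unfolding compact_operator_def
    by (simp add: cinner_add_left scaleC_add_left cinner_scaleC_left scaleC_scaleC)
qed

section \<open>Lifting a rank-one projection\<close>

text \<open>If \<open>x\<close> lifts the projection \<open>p\<close> onto the line of a unit vector
  \<open>v\<close>, then \<open>star x * x\<close> is positive and lifts \<open>p\<close> as well.
  Minimality comes from \<open>p T p = cinner (T v) v p\<close>.\<close>

lemma quotient_iso_compacts_minimal_projection:
  fixes \<phi> :: "'a::cstar_algebra set \<Rightarrow> 'h::complex_hilbert \<Rightarrow> 'h" and v0 :: 'h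
  assumes I: "closed_ideal UNIV I" and J: "closed_ideal UNIV J"
    and \<phi>: "quotient_iso_compacts I J \<phi>" and "v0 \<noteq> 0"
  obtains e where "positive e" "e * e - e \<in> J" "e \<notin> J" "\<And>x. \<exists>c. e * x * e - c *\<^sub>C e \<in> J"
proof -
  note DI = closed_ideal_UNIV_D[OF I]
  note DJ = closed_ideal_UNIV_D[OF J]
  have subJ: "subspace J"
    using J by (simp add: closed_ideal_def csubspace_def)
  have bij: "bij_betw \<phi> (coset J ` I) {T. compact_operator T}"
    and scale: "\<And>c x. x \<in> I \<Longrightarrow> \<phi> (coset J (c *\<^sub>C x)) = (\<lambda>v. c *\<^sub>C \<phi> (coset J x) v)"
    and mult: "\<And>x y. x \<in> I \<Longrightarrow> y \<in> I \<Longrightarrow> \<phi> (coset J (x * y)) = \<phi> (coset J x) \<circ> \<phi> (coset J y)"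
    and adj: "\<And>x u v. x \<in> I \<Longrightarrow> cinner (\<phi> (coset J x) u) v = cinner u (\<phi> (coset J (star x)) v)"
    using \<phi> unfolding quotient_iso_compacts_def by blast+
  have inj: "x - y \<in> J" if "\<phi> (coset J x) = \<phi> (coset J y)" "x \<in> I" "y \<in> I" for x y
    using inj_onD[OF bij_betw_imp_inj_on[OF bij] that(1)] that(2,3) coset_eq_iff[OF subJ] by blast
  define v where "v = (1 / norm v0) *\<^sub>R v0"
  have v: "norm v = 1"
    using \<open>v0 \<noteq> 0\<close> by (simp add: v_def)
  have vv: "cinner v v = 1"
    by (simp add: cinner_self v)
  define p where "p = (\<lambda>u. cinner u v *\<^sub>C v)"
  have pp: "p (p u) = p u" for u
    by (simp add: p_def cinner_scaleC_left vv)
  have "p \<in> \<phi> ` coset J ` I"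
    using bij_betw_imp_surj_on[OF bij] compact_operator_rank_one[OF v] by (simp add: p_def)
  then obtain x where x: "x \<in> I" "\<phi> (coset J x) = p"
    by auto
  have sx: "star x \<in> I"
    using closed_ideal_star[OF I x(1)] .
  define e where "e = star x * x"
  have eI: "e \<in> I"
    using DI(8) x(1) by (simp add: e_def)
  \<comment> \<open>The image of \<open>star x\<close> is the adjoint of \<open>p\<close>, and
    \<open>p\<close> is self-adjoint.\<close>
  have "\<phi> (coset J (star x)) w = p w" for w
  proof (rule cinner_right_eqI)
    fix u
    have "cinner (p u) w = cinner u (p w)"
      by (simp add: p_def cinner_scaleC_left cinner_scaleC_right cinner_commute[of w v])
    then show "cinner u (\<phi> (coset J (star x)) w) = cinner u (p w)"
      using adj[OF x(1), of u w] x(2) by simp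
  qed
  then have \<phi>e: "\<phi> (coset J e) = p"
    unfolding e_def mult[OF sx x(1)] x(2) by (simp add: fun_eq_iff pp)
  show thesis
  proof (rule that)
    show "positive e"
      unfolding positive_def e_def by blast
    have "\<phi> (coset J (e * e)) = \<phi> (coset J e)"
      unfolding mult[OF eI eI] \<phi>e by (simp add: fun_eq_iff pp)
    then show ee: "e * e - e \<in> J"
      using inj DI(7) eI by blast
    show "e \<notin> J"
    proof
      assume "e \<in> J"
      \<comment> \<open>Writing the zero coset as that of \<open>0 *\<^sub>C e\<close> lets
        homogeneity of \<open>\<phi>\<close> give \<open>p = 0\<close>.\<close>
      then have "coset J e = coset J (0 *\<^sub>C e)"
        using coset_eq_iff[OF subJ, of e "0 *\<^sub>C e"] by simp
      then have "p v = 0"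
        using scale[OF eI, of 0] \<phi>e by (simp add: fun_eq_iff)
      then show False
        using v by (auto simp: p_def vv)
    qed
    fix y :: 'a
    \<comment> \<open>\<open>y\<close> need not lie in \<open>I\<close>, but
      \<open>e * y * e\<close> does, so \<open>\<phi>\<close> applies to it. Multiplying by
      \<open>e\<close> on both sides again produces \<open>p T p\<close> and changes nothing modulo
      \<open>J\<close>.\<close>
    define z where "z = e * y * e"
    have zI: "z \<in> I"
      using DI(8) eI by (simp add: z_def)
    define T where "T = \<phi> (coset J z)"
    have "compact_operator T"
      using bij_betw_apply[OF bij] zI unfolding T_def by blast
    then have T: "T (c *\<^sub>C u) = c *\<^sub>C T u" for c u
      unfolding compact_operator_def by blast
    have ez: "e * z \<in> I"
      using DI(7) eI by blast
    then have "\<phi> (coset J (e * z * e)) = p \<circ> T \<circ> p"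
      by (simp add: mult eI zI \<phi>e T_def)
    also have "\<dots> = \<phi> (coset J (cinner (T v) v *\<^sub>C e))"
      by (simp add: scale[OF eI] \<phi>e fun_eq_iff p_def T cinner_scaleC_left scaleC_scaleC mult.commute)
    finally have "e * z * e - cinner (T v) v *\<^sub>C e \<in> J"
      using inj DI(6,7) ez eI by blast
    moreover have "e * z * e - z = (e * e - e) * (y * e * e) + (e * y) * (e * e - e)"
      by (simp add: z_def algebra_simps)
    then have "e * z * e - z \<in> J"
      using ee DJ(3,7,8) by metis
    ultimately have "(e * z * e - cinner (T v) v *\<^sub>C e) - (e * z * e - z) \<in> J"
      using DJ(4) by blast
    then show "\<exists>c. e * y * e - c *\<^sub>C e \<in> J"
      by (auto simp: z_def)
  qed
qed

theorem proposition7p4: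
  fixes \<Sigma> :: "'s::cu_semigroup set"
  shows "(cu_scale \<Sigma> \<and> property_O6 TYPE('s) \<and> abundance_of_strongly_soft_elements \<Sigma>
            \<longrightarrow> weakly_2_omega_divisible TYPE('s)) \<and>
         (abundance_of_soft_elements TYPE('a::cstar_algebra)
            \<longrightarrow> nowhere_scattered_wrt TYPE('h::complex_hilbert) TYPE('a))"
proof (intro conjI impI)
  assume "cu_scale \<Sigma> \<and> property_O6 TYPE('s) \<and> abundance_of_strongly_soft_elements \<Sigma>"
  then show "weakly_2_omega_divisible TYPE('s)"
    using weakly_2_omega_divisible by blast
next
  assume soft: "abundance_of_soft_elements TYPE('a)"
  show "nowhere_scattered_wrt TYPE('h) TYPE('a)"
    unfolding nowhere_scattered_wrt_def
  proof (intro impI notI; elim exE conjE)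
    fix I J :: "'a set" and \<phi> :: "'a set \<Rightarrow> 'h \<Rightarrow> 'h" and v :: 'h
    assume "v \<noteq> 0" "closed_ideal UNIV I" "closed_ideal UNIV J" "quotient_iso_compacts I J \<phi>"
    then show False
      using quotient_iso_compacts_minimal_projection not_abundance_of_soft_elements soft by metis
  qed
qed

end
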